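(* Let $G$ be Grigorchuk's $2$-group, let $\gamma$ denote its growth, and let $\alpha=0.5157$. Then $\gamma(n)\succsim e^{n^{\alpha}}$.
   Context: Grigorchuk's $2$-group: let $\Sigma=\{0,1\}$, let $\Sigma^*$ be the set of finite sequences over $\Sigma$, and for $x\in\Sigma$ put $\overline x=1-x$. Define recursively length-preserving permutations $a,b,c,d$ of $\Sigma^*$ by, for $x\in\Sigma$ and $\sigma\in\Sigma^*$: $a(x\sigma)=\overline x\sigma$; $b(0\sigma)=0a(\sigma)$, $b(1\sigma)=1c(\sigma)$; $c(0\sigma)=0a(\sigma)$, $c(1\sigma)=1d(\sigma)$; $d(0\sigma)=0\sigma$, $d(1\sigma)=1b(\sigma)$. Then $G$ is the group of permutations generated by $S=\{a,b,c,d\}$. Weights and growth: write $\mathbb R_+=[0,\infty)$. Let $G$ be a group generated as a monoid by a finite set $S$. A weight on $(G,S)$ is a function $\omega:S\to(0,\infty)$. It induces $\partial_\omega:G\to\mathbb R_+$, $\partial_\omega(g)=\min\{\omega(s_1)+\dots+\omega(s_n) : s_i\in S,\ s_1\cdots s_n=g\}$. The growth of $G$ with respect to $\omega$ is the function $\gamma_\omega:\mathbb R_+\to\mathbb R_+$, $\gamma_\omega(n)=\#\{g\in G : \partial_\omega(g)\le n\}$. For functions $\gamma,\delta:\mathbb R_+\to\mathbb R_+$, write $\gamma\precsim\delta$ (equivalently $\delta\succsim\gamma$) if there is a constant $C\in\mathbb R_+$ with $\gamma(n)\le\delta(Cn)$ for all $n\in\mathbb R_+$, and $\gamma\sim\delta$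 if $\gamma\precsim\delta$ and $\delta\precsim\gamma$. The functions $\gamma_\omega$, for all finite generating sets and all weights on them, are $\sim$-equivalent; the growth of $G$ is their $\sim$-equivalence class.
   Formalization: The inequality e^{n^α} ≤ γ(Cn) is required for all real n ≥ 1 instead of all n in R_+, because near 0 the growth function is at most 1 while e^{n^α} > 1 for every n > 0, so the literal relation fails. *)

theory Defs
  imports Complex_Main "HOL-Algebra.Bij" "HOL-Algebra.Elementary_Groups"
begin

text \<open>Words over \<open>{0,1}\<close> are boolean lists, with \<^const>\<open>False\<close> for \<open>0\<close> and \<^const>\<open>True\<close> for \<open>1\<close>.\<close>

fun grig_a :: "bool list \<Rightarrow> bool list" where
  "grig_a [] = []"
| "grig_a (x # \<sigma>) = (\<not> x) # \<sigma>"

fun grig_b :: "bool list \<Rightarrow> bool list"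
  and grig_c :: "bool list \<Rightarrow> bool list"
  and grig_d :: "bool list \<Rightarrow> bool list" where
  "grig_b [] = []"
| "grig_b (False # \<sigma>) = False # grig_a \<sigma>"
| "grig_b (True # \<sigma>) = True # grig_c \<sigma>"
| "grig_c [] = []"
| "grig_c (False # \<sigma>) = False # grig_a \<sigma>"
| "grig_c (True # \<sigma>) = True # grig_d \<sigma>"
| "grig_d [] = []"
| "grig_d (False # \<sigma>) = False # \<sigma>"
| "grig_d (True # \<sigma>) = True # grig_b \<sigma>"

definition grig_gens :: "(bool list \<Rightarrow> bool list) set" where
  "grig_gens = {grig_a, grig_b, grig_c, grig_d}"

definition grigorchuk_group :: "(bool list \<Rightarrow> bool list) monoid" where
  "grigorchuk_group = subgroup_generated (BijGroup UNIV) grig_gens"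

lemma grig_a_invol: "grig_a (grig_a \<sigma>) = \<sigma>"
  by (cases \<sigma>) auto

lemma grig_bcd_invol:
  "grig_b (grig_b \<sigma>) = \<sigma>" "grig_c (grig_c \<sigma>) = \<sigma>" "grig_d (grig_d \<sigma>) = \<sigma>"
  by (induction \<sigma> and \<sigma> and \<sigma> rule: grig_b_grig_c_grig_d.induct)
     (simp_all add: grig_a_invol)

text \<open>\<^const>\<open>subgroup_generated\<close> discards generators outside the ambient carrier; the next
  lemma shows that none is discarded here.\<close>

lemma grig_gens_Bij: "grig_gens \<subseteq> carrier (BijGroup UNIV)"
  using grig_a_invol grig_bcd_invol
  by (auto simp: grig_gens_def BijGroup_def Bij_def intro!: o_bij ext)

definition word_prod :: "('a, 'b) monoid_scheme \<Rightarrow> 'a list \<Rightarrow> 'a" where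
  "word_prod G w = foldr (\<lambda>x y. x \<otimes>\<^bsub>G\<^esub> y) w \<one>\<^bsub>G\<^esub>"

definition monoid_generates :: "('a, 'b) monoid_scheme \<Rightarrow> 'a set \<Rightarrow> bool" where
  "monoid_generates G S \<longleftrightarrow> S \<subseteq> carrier G \<and> carrier G = word_prod G ` lists S"

definition is_weight :: "'a set \<Rightarrow> ('a \<Rightarrow> real) \<Rightarrow> bool" where
  "is_weight S \<omega> \<longleftrightarrow> (\<forall>s\<in>S. \<omega> s > 0)"

text \<open>For finite \<open>S\<close> and positive \<open>\<omega>\<close> only finitely many words have weight below a given bound, so
  the minimum below is attained whenever \<open>S\<close> generates \<open>G\<close> as a monoid.\<close>

definition weight_norm ::
    "('a, 'b) monoid_scheme \<Rightarrow> 'a set \<Rightarrow> ('a \<Rightarrow> real) \<Rightarrow> 'a \<Rightarrow> real" where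
  "weight_norm G S \<omega> g = (LEAST r. \<exists>w\<in>lists S. word_prod G w = g \<and> r = sum_list (map \<omega> w))"

definition growth_fun ::
    "('a, 'b) monoid_scheme \<Rightarrow> 'a set \<Rightarrow> ('a \<Rightarrow> real) \<Rightarrow> real \<Rightarrow> real" where
  "growth_fun G S \<omega> n = real (card {g \<in> carrier G. weight_norm G S \<omega> g \<le> n})"

text \<open>Functions \<open>\<real>\<^sub>+ \<rightarrow> \<real>\<^sub>+\<close> are functions on the reals that are nonnegative on \<open>{0..}\<close>; values at
  negative arguments play no role. The set \<open>A\<close> collects the arguments at which the inequality is
  required; the usual preorder on growth functions is the case \<open>A = {0..}\<close>.\<close>

definition dominated_on :: "real set \<Rightarrow> (real \<Rightarrow> real) \<Rightarrow> (real \<Rightarrow> real) \<Rightarrow> bool" where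
  "dominated_on A \<gamma> \<delta> \<longleftrightarrow> (\<exists>C\<ge>0. \<forall>n\<in>A. \<gamma> n \<le> \<delta> (C * n))"

definition growth_equiv :: "(real \<Rightarrow> real) \<Rightarrow> (real \<Rightarrow> real) \<Rightarrow> bool" where
  "growth_equiv \<gamma> \<delta> \<longleftrightarrow> dominated_on {0..} \<gamma> \<delta> \<and> dominated_on {0..} \<delta> \<gamma>"

text \<open>The growth of \<open>G\<close> is an equivalence class; all the functions \<^term>\<open>growth_fun G S \<omega>\<close> lie in
  the same class.\<close>

definition growth :: "('a, 'b) monoid_scheme \<Rightarrow> (real \<Rightarrow> real) set" where
  "growth G = {\<gamma>. (\<forall>n\<ge>0. \<gamma> n \<ge> 0) \<and>
     (\<exists>S \<omega>. finite S \<and> monoid_generates G S \<and> is_weight S \<omega> \<and> growth_equiv \<gamma> (growth_fun G S \<omega>))}"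

lemma grig_gens_generate: "monoid_generates grigorchuk_group grig_gens"
proof -
  let ?B = "BijGroup (UNIV :: bool list set)" and ?G = grigorchuk_group
  interpret B: group ?B by (rule group_BijGroup)
  have mult: "mult ?G = mult ?B" and one_eq: "one ?G = one ?B"
    by (simp_all add: grigorchuk_group_def)
  have carr: "carrier ?G = generate ?B grig_gens"
    using grig_gens_Bij by (simp add: grigorchuk_group_def carrier_subgroup_generated inf.absorb2)
  interpret G: group ?G
    unfolding grigorchuk_group_def by (rule B.group_subgroup_generated)
  have sub: "grig_gens \<subseteq> carrier ?G"
    by (auto simp: carr intro: generate.incl)
  have closed: "word_prod ?G w \<in> carrier ?G" if "w \<in> lists grig_gens" for w
    using that sub by (induction w) (auto simp: word_prod_def)
  have append: "word_prod ?G (v @ w) = word_prod ?G v \<otimes>\<^bsub>?G\<^esub> word_prod ?G w"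
    if "v \<in> lists grig_gens" "w \<in> lists grig_gens" for v w
    using that
  proof (induction v)
    case Nil
    then show ?case using closed[of w] by (simp add: word_prod_def)
  next
    case (Cons s v)
    then show ?case using closed[of v] closed[of w] sub
      by (auto simp: word_prod_def G.m_assoc subset_iff)
  qed
  have gen: "s \<in> word_prod ?G ` lists grig_gens" if "s \<in> grig_gens" for s
  proof -
    have "word_prod ?G [s] = s" using that sub by (auto simp: word_prod_def)
    then show ?thesis using that by (intro image_eqI[where x = "[s]"]) auto
  qed
  have inv: "inv\<^bsub>?B\<^esub> s = s" if "s \<in> grig_gens" for s
  proof -
    have s: "s \<in> carrier ?B" using that grig_gens_Bij by auto
    have "s (s \<sigma>) = \<sigma>" for \<sigma>
      using that grig_a_invol grig_bcd_invol by (auto simp: grig_gens_def)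
    then have "s \<otimes>\<^bsub>?B\<^esub> s = \<one>\<^bsub>?B\<^esub>"
      using s by (auto simp: BijGroup_def compose_def)
    then show ?thesis using s B.inv_equality by blast
  qed
  have "g \<in> word_prod ?G ` lists grig_gens" if "g \<in> generate ?B grig_gens" for g
    using that
  proof induction
    case one
    then show ?case by (auto simp: word_prod_def one_eq intro!: image_eqI[where x = "[]"])
  next
    case (incl h)
    then show ?case by (rule gen)
  next
    case (inv h)
    then show ?case using gen \<open>\<And>s. s \<in> grig_gens \<Longrightarrow> inv\<^bsub>?B\<^esub> s = s\<close> by simp
  next
    case (eng g h)
    then obtain v w where "v \<in> lists grig_gens" "w \<in> lists grig_gens"
      "g = word_prod ?G v" "h = word_prod ?G w" by auto
    then show ?case using append mult
      by (intro image_eqI[where x = "v @ w"]) auto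
  qed
  then show ?thesis
    using closed sub carr by (auto simp: monoid_generates_def)
qed

lemma growth_equiv_refl: "growth_equiv \<gamma> \<gamma>"
  unfolding growth_equiv_def dominated_on_def by (auto intro!: exI[of _ 1])

lemma growth_fun_in_growth:
  assumes "finite S" "monoid_generates G S" "is_weight S \<omega>"
  shows "growth_fun G S \<omega> \<in> growth G"
  using assms growth_equiv_refl unfolding growth_def growth_fun_def by fastforce

lemma grigorchuk_growth_nonempty:
  "growth_fun grigorchuk_group grig_gens (\<lambda>_. 1) \<in> growth grigorchuk_group"
  by (rule growth_fun_in_growth[OF _ grig_gens_generate])
     (auto simp: grig_gens_def is_weight_def)

lemma weight_norm_attained:
  assumes "finite S" "is_weight S \<omega>" "monoid_generates G S" "g \<in> carrier G"
  shows "\<exists>w\<in>lists S. word_prod G w = g \<and> weight_norm G S \<omega> g = sum_list (map \<omega> w)"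
    and "w \<in> lists S \<Longrightarrow> word_prod G w = g \<Longrightarrow> weight_norm G S \<omega> g \<le> sum_list (map \<omega> w)"
proof -
  define P where "P r \<longleftrightarrow> (\<exists>w\<in>lists S. word_prod G w = g \<and> r = sum_list (map \<omega> w))" for r
  obtain m where m: "m > 0" "\<And>s. s \<in> S \<Longrightarrow> m \<le> \<omega> s"
  proof -
    have "\<forall>s\<in>S. Min (insert 1 (\<omega> ` S)) \<le> \<omega> s" "Min (insert 1 (\<omega> ` S)) > 0"
      using assms(1,2) by (auto simp: is_weight_def)
    then show ?thesis using that by blast
  qed
  have len: "m * length w \<le> sum_list (map \<omega> w)" if "w \<in> lists S" for w
    using that by (induction w) (auto simp: algebra_simps dest: m(2))
  obtain w0 where w0: "w0 \<in> lists S" "word_prod G w0 = g"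
    using assms(3,4) by (auto simp: monoid_generates_def)
  define R where "R = sum_list (map \<omega> w0)"
  define A where "A = {r. P r \<and> r \<le> R}"
  have "A \<subseteq> (\<lambda>w. sum_list (map \<omega> w)) ` {w. set w \<subseteq> S \<and> length w \<le> nat \<lceil>R / m\<rceil>}"
  proof
    fix r assume "r \<in> A"
    then obtain w where w: "w \<in> lists S" "r = sum_list (map \<omega> w)" "r \<le> R"
      by (auto simp: A_def P_def)
    have "real (length w) \<le> R / m"
      using len[OF w(1)] w m(1) by (simp add: field_simps)
    then have "length w \<le> nat \<lceil>R / m\<rceil>" by linarith
    then show "r \<in> (\<lambda>w. sum_list (map \<omega> w)) ` {w. set w \<subseteq> S \<and> length w \<le> nat \<lceil>R / m\<rceil>}"
      using w by auto
  qed
  then have fin: "finite A"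
    using finite_lists_length_le[OF assms(1)] finite_surj by blast
  have RA: "R \<in> A" using w0 by (auto simp: A_def P_def R_def)
  have least: "P (Min A) \<and> (\<forall>r. P r \<longrightarrow> Min A \<le> r)"
  proof -
    have "Min A \<in> A" using fin RA by (intro Min_in) auto
    moreover have "Min A \<le> r" if "P r" for r
    proof (cases "r \<le> R")
      case True
      then show ?thesis using that fin by (auto simp: A_def)
    next
      case False
      then show ?thesis using Min_le[OF fin RA] by simp
    qed
    ultimately show ?thesis by (auto simp: A_def)
  qed
  then have eq: "weight_norm G S \<omega> g = Min A"
    unfolding weight_norm_def P_def[symmetric] by (intro Least_equality) auto
  show "\<exists>w\<in>lists S. word_prod G w = g \<and> weight_norm G S \<omega> g = sum_list (map \<omega> w)"
    using least eq by (auto simp: P_def)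
  show "w \<in> lists S \<Longrightarrow> word_prod G w = g \<Longrightarrow> weight_norm G S \<omega> g \<le> sum_list (map \<omega> w)"
    using least eq by (auto simp: P_def)
qed

lemma growth_near_0:
  assumes "\<gamma> \<in> growth G"
  obtains \<epsilon> where "\<epsilon> > 0" "\<And>n. 0 \<le> n \<Longrightarrow> n < \<epsilon> \<Longrightarrow> \<gamma> n \<le> 1"
proof -
  obtain S \<omega> where S: "finite S" "monoid_generates G S" "is_weight S \<omega>"
    and "growth_equiv \<gamma> (growth_fun G S \<omega>)"
    using assms by (auto simp: growth_def)
  then obtain C where C: "C \<ge> 0" "\<And>n. n \<ge> 0 \<Longrightarrow> \<gamma> n \<le> growth_fun G S \<omega> (C * n)"
    by (auto simp: growth_equiv_def dominated_on_def)
  define m where "m = Min (insert 1 (\<omega> ` S))"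
  have m: "m > 0" "\<And>s. s \<in> S \<Longrightarrow> m \<le> \<omega> s"
    using S by (auto simp: is_weight_def m_def)
  have small: "growth_fun G S \<omega> n \<le> 1" if "n < m" for n
  proof -
    have "{g \<in> carrier G. weight_norm G S \<omega> g \<le> n} \<subseteq> {\<one>\<^bsub>G\<^esub>}"
    proof safe
      fix g assume g: "g \<in> carrier G" "weight_norm G S \<omega> g \<le> n"
      obtain w where w: "w \<in> lists S" "word_prod G w = g" "weight_norm G S \<omega> g = sum_list (map \<omega> w)"
        using weight_norm_attained(1)[OF S(1,3,2) g(1)] by blast
      have "w = []"
      proof (cases w)
        case (Cons s v)
        have "0 \<le> sum_list (map \<omega> v)"
          using w(1) S(3) unfolding Cons is_weight_def
          by (intro sum_list_nonneg) (auto intro: less_imp_le)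
        then have "m \<le> sum_list (map \<omega> w)" using m(2)[of s] w(1) Cons by auto
        then show ?thesis using g w \<open>n < m\<close> by simp
      qed
      then show "g = \<one>\<^bsub>G\<^esub>" using w by (simp add: word_prod_def)
    qed
    then have "card {g \<in> carrier G. weight_norm G S \<omega> g \<le> n} \<le> card {\<one>\<^bsub>G\<^esub>}"
      by (intro card_mono) auto
    then show ?thesis by (simp add: growth_fun_def)
  qed
  show thesis
  proof (rule that)
    show "m / (C + 1) > 0" using m C by simp
    fix n :: real assume "0 \<le> n" "n < m / (C + 1)"
    then have "C * n < m" using C m by (simp add: field_simps)
    then show "\<gamma> n \<le> 1" using C(2)[OF \<open>0 \<le> n\<close>] small[of "C * n"] by linarith
  qed
qed

text \<open>Since \<open>exp (n powr \<alpha>) > 1\<close> for all \<open>n > 0\<close>, a lower bound of this shape cannot hold at all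
  \<open>n \<ge> 0\<close>. It is meant away from \<open>0\<close>, i.e. with \<open>A = {1..}\<close>.\<close>

lemma not_exp_dominated_at_0:
  assumes "\<gamma> \<in> growth G"
  shows "\<not> dominated_on {0..} (\<lambda>n. exp (n powr \<alpha>)) \<gamma>"
proof
  assume "dominated_on {0..} (\<lambda>n. exp (n powr \<alpha>)) \<gamma>"
  then obtain C where C: "C \<ge> 0" "\<And>n. n \<ge> 0 \<Longrightarrow> exp (n powr \<alpha>) \<le> \<gamma> (C * n)"
    by (auto simp: dominated_on_def)
  obtain \<epsilon> where e: "\<epsilon> > 0" "\<And>n. 0 \<le> n \<Longrightarrow> n < \<epsilon> \<Longrightarrow> \<gamma> n \<le> 1"
    using growth_near_0[OF assms] by blast
  define n where "n = \<epsilon> / (C + 1)"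
  have n: "n > 0" "C * n < \<epsilon>" using C e by (auto simp: n_def field_simps)
  have "0 \<le> C * n" using n C by simp
  then have "exp (n powr \<alpha>) \<le> 1" using C(2)[of n] e(2)[of "C * n"] n by linarith
  then show False using n(1) by simp
qed

end

theory Submission
  imports Defs
begin

text \<open>
  Every \<open>g\<close> fixing the first level is a pair of sections, e.g. \<open>b = (a, c)\<close>, \<open>c = (a, d)\<close>,
  \<open>d = (1, b)\<close>. Consider the elements \<open>a t\<^sub>1 a t\<^sub>2 \<dots> a t\<^sub>m\<close> whose letters \<open>t\<^sub>i\<close> avoid one of
  \<open>b\<close>, \<open>c\<close>, \<open>d\<close>.
  If only \<open>c\<close> and \<open>d\<close> occur, two elements of length \<open>m\<close> are the two sections of one element of
  length \<open>2m\<close> with letters \<open>b\<close> and \<open>c\<close>: alternating letters feed the two coordinates, and the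
  \<open>a\<close>-sections of the letters of one coordinate are exactly the separators of the other.
  In the other two cases the two sections are lifted one after the other. Lifting \<open>a t\<close> to
  \<open>a f a t'\<close>, with a fixed filler letter \<open>f\<close>, leaves in the other coordinate an error in a finite
  group. With filler \<open>b\<close>, words in \<open>b, c\<close> become words in \<open>b, d\<close>; with filler \<open>c\<close>, words in \<open>b, d\<close>
  become words in \<open>c, d\<close>. These two lifts cost a factor \<open>4\<close> each in length.
  After the three rounds the length has grown by \<open>2 \<cdot> 4 \<cdot> 4 = 32\<close>, while the number of elements
  has been raised to the power \<open>8\<close>, up to a constant factor. This gives the exponent
  \<open>log 8 / log 32 = 3/5\<close>, which exceeds \<open>0.5157\<close>.
\<close>

section \<open>Sections on the first level\<close>

fun tree_pair :: "(bool list \<Rightarrow> bool list) \<Rightarrow> (bool list \<Rightarrow> bool list) \<Rightarrow> bool list \<Rightarrow> bool list" where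
  "tree_pair g h [] = []"
| "tree_pair g h (x # \<sigma>) = x # (if x then h \<sigma> else g \<sigma>)"

definition section0 :: "(bool list \<Rightarrow> bool list) \<Rightarrow> bool list \<Rightarrow> bool list" where
  "section0 g \<sigma> = tl (g (False # \<sigma>))"

definition section1 :: "(bool list \<Rightarrow> bool list) \<Rightarrow> bool list \<Rightarrow> bool list" where
  "section1 g \<sigma> = tl (g (True # \<sigma>))"

lemma section_tree_pair [simp]:
  "section0 (tree_pair g h) = g" "section1 (tree_pair g h) = h"
  by (auto simp: section0_def section1_def)

lemma grig_b_pair: "grig_b = tree_pair grig_a grig_c"
  and grig_c_pair: "grig_c = tree_pair grig_a grig_d"
  and grig_d_pair: "grig_d = tree_pair id grig_b"
proof -
  have "grig_b \<sigma> = tree_pair grig_a grig_c \<sigma>" "grig_c \<sigma> = tree_pair grig_a grig_d \<sigma>"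
    "grig_d \<sigma> = tree_pair id grig_b \<sigma>" for \<sigma>
    by (cases \<sigma> rule: grig_b.cases; simp)+
  then show "grig_b = tree_pair grig_a grig_c" "grig_c = tree_pair grig_a grig_d"
    "grig_d = tree_pair id grig_b" by blast+
qed

lemma grig_a_comp_grig_a [simp]: "grig_a \<circ> grig_a = id"
  by (auto simp: grig_a_invol)

lemma grig_a_cancel [simp]: "grig_a \<circ> (grig_a \<circ> g) = g"
  by (auto simp: grig_a_invol)

lemma tree_pair_comp: "tree_pair g h \<circ> tree_pair g' h' = tree_pair (g \<circ> g') (h \<circ> h')"
proof
  show "(tree_pair g h \<circ> tree_pair g' h') \<sigma> = tree_pair (g \<circ> g') (h \<circ> h') \<sigma>" for \<sigma>
    by (cases \<sigma>) auto
qed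

lemma tree_pair_id: "tree_pair id id = id"
proof
  show "tree_pair id id \<sigma> = id \<sigma>" for \<sigma> by (cases \<sigma>) auto
qed

lemma conj_id: "grig_a \<circ> (id \<circ> grig_a) = id"
  by simp

lemma tree_pair_grig_a: "tree_pair g h \<circ> grig_a = grig_a \<circ> tree_pair h g"
proof
  show "(tree_pair g h \<circ> grig_a) \<sigma> = (grig_a \<circ> tree_pair h g) \<sigma>" for \<sigma>
    by (cases \<sigma>) auto
qed

text \<open>Conjugation by \<open>a\<close> swaps the two sections. The trailing \<open>k\<close>
  lets the rule rewrite inside right-nested composites.\<close>

lemma conj_tree_pair: "grig_a \<circ> (tree_pair g h \<circ> (grig_a \<circ> k)) = tree_pair h g \<circ> k"
  by (metis comp_assoc tree_pair_grig_a grig_a_cancel)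

lemma bij_grig_a: "bij grig_a" and bij_grig_b: "bij grig_b"
  by (auto intro!: o_bij[of grig_a grig_a] o_bij[of grig_b grig_b]
      simp: grig_a_invol grig_bcd_invol)

lemma bij_tree_pair:
  assumes "bij g" "bij h"
  shows "bij (tree_pair g h)"
proof (rule o_bij)
  show "tree_pair (inv_into UNIV g) (inv_into UNIV h) \<circ> tree_pair g h = id"
    "tree_pair g h \<circ> tree_pair (inv_into UNIV g) (inv_into UNIV h) = id"
    using assms by (simp_all add: tree_pair_comp tree_pair_id bij_is_inj bij_is_surj
        surj_iff[THEN iffD1])
qed

section \<open>Elements spelled by restricted words\<close>

fun word_map :: "(bool list \<Rightarrow> bool list) list \<Rightarrow> bool list \<Rightarrow> bool list" where
  "word_map [] = id"
| "word_map (t # ts) = grig_a \<circ> (t \<circ> word_map ts)"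

text \<open>A set of maps rather than of words, so its cardinality counts group elements. The length
  is exact, so that lengths add up under composition.\<close>

definition spelled :: "(bool list \<Rightarrow> bool list) set \<Rightarrow> nat \<Rightarrow> (bool list \<Rightarrow> bool list) set" where
  "spelled T m = word_map ` {ts \<in> lists T. length ts = m}"

lemma finite_spelled: "finite T \<Longrightarrow> finite (spelled T m)"
  unfolding spelled_def using finite_lists_length_eq[of T m]
  by (auto intro!: finite_imageI simp: lists_eq_set)

lemma spelled_0: "spelled T 0 = {id}"
  by (auto simp: spelled_def)

lemma spelled_SucI: "t \<in> T \<Longrightarrow> g \<in> spelled T m \<Longrightarrow> grig_a \<circ> (t \<circ> g) \<in> spelled T (Suc m)"
proof -
  assume "t \<in> T" "g \<in> spelled T m"
  then obtain ts where "ts \<in> lists T" "length ts = m" "g = word_map ts"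
    by (auto simp: spelled_def)
  then show ?thesis using \<open>t \<in> T\<close>
    unfolding spelled_def by (intro image_eqI[of _ _ "t # ts"]) auto
qed

lemma spelled_SucE:
  assumes "g \<in> spelled T (Suc m)"
  obtains t h where "t \<in> T" "h \<in> spelled T m" "g = grig_a \<circ> (t \<circ> h)"
proof -
  obtain us where us: "us \<in> lists T" "length us = Suc m" "g = word_map us"
    using assms by (auto simp: spelled_def)
  then obtain t ts where "us = t # ts" "length ts = m" by (auto simp: length_Suc_conv)
  then show thesis using us that[of t "word_map ts"] by (auto simp: spelled_def)
qed

lemma word_map_append: "word_map (ts @ us) = word_map ts \<circ> word_map us"
  by (induction ts) (auto simp: comp_assoc)

lemma spelled_comp: "g \<in> spelled T m \<Longrightarrow> h \<in> spelled T n \<Longrightarrow> g \<circ> h \<in> spelled T (m + n)"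
proof -
  assume "g \<in> spelled T m" "h \<in> spelled T n"
  then obtain ts us where "ts \<in> lists T" "length ts = m" "g = word_map ts"
    "us \<in> lists T" "length us = n" "h = word_map us"
    by (auto simp: spelled_def)
  then show ?thesis
    unfolding spelled_def by (intro image_eqI[of _ _ "ts @ us"]) (auto simp: word_map_append)
qed

section \<open>Lifting two elements in parallel\<close>

text \<open>With \<open>g = a s g'\<close> and \<open>h = a t h'\<close>, the two new blocks
  multiply to \<open>a (a,s) a (a,t) = (s a, a t)\<close>. The left coordinate reads each letter
  before its separator, hence the conjugate of \<open>g\<close> by \<open>a\<close>.\<close>

lemma parallel_lift:
  assumes "g \<in> spelled {grig_c, grig_d} m" "h \<in> spelled {grig_c, grig_d} m"
  shows "tree_pair (grig_a \<circ> (g \<circ> grig_a)) h \<in> spelled {grig_b, grig_c} (2 * m)"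
  using assms
proof (induction m arbitrary: g h)
  case 0
  then have "g = id" "h = id" by (simp_all add: spelled_0)
  then show ?case
    by (simp only: conj_id tree_pair_id spelled_0 mult_0_right singleton_iff)
next
  case (Suc m)
  obtain s g' where s: "s \<in> {grig_c, grig_d}" "g' \<in> spelled {grig_c, grig_d} m"
    "g = grig_a \<circ> (s \<circ> g')" using Suc.prems(1) by (rule spelled_SucE)
  obtain t h' where t: "t \<in> {grig_c, grig_d}" "h' \<in> spelled {grig_c, grig_d} m"
    "h = grig_a \<circ> (t \<circ> h')" using Suc.prems(2) by (rule spelled_SucE)
  \<comment> \<open>This is \<open>(a,c) = b\<close> and \<open>(a,d) = c\<close>.\<close>
  have lift: "tree_pair grig_a u \<in> {grig_b, grig_c}" if "u \<in> {grig_c, grig_d}" for u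
    using that by (auto simp flip: grig_b_pair grig_c_pair)
  have "grig_a \<circ> (tree_pair grig_a s \<circ> (grig_a \<circ> (tree_pair grig_a t \<circ>
      tree_pair (grig_a \<circ> (g' \<circ> grig_a)) h'))) \<in> spelled {grig_b, grig_c} (Suc (Suc (2 * m)))"
    by (rule spelled_SucI[OF lift[OF s(1)] spelled_SucI[OF lift[OF t(1)] Suc.IH[OF s(2) t(2)]]])
  then show ?case
    by (simp only: conj_tree_pair tree_pair_comp comp_assoc s(3) t(3) grig_a_cancel
        mult_Suc_right add_2_eq_Suc)
qed

text \<open>The parallel lift is injective: its sections return \<open>h\<close> and the conjugate
  of \<open>g\<close>.\<close>

lemma card_parallel_lift:
  "(card (spelled {grig_c, grig_d} m))\<^sup>2 \<le> card (spelled {grig_b, grig_c} (2 * m))"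
proof -
  let ?A = "spelled {grig_c, grig_d} m"
  let ?f = "\<lambda>(g, h). tree_pair (grig_a \<circ> (g \<circ> grig_a)) h"
  have "inj_on ?f (?A \<times> ?A)"
  proof (rule inj_onI, clarify)
    fix g h g' h'
    assume eq: "tree_pair (grig_a \<circ> (g \<circ> grig_a)) h = tree_pair (grig_a \<circ> (g' \<circ> grig_a)) h'"
    have "grig_a \<circ> (g \<circ> grig_a) = grig_a \<circ> (g' \<circ> grig_a)" "h = h'"
      using arg_cong[OF eq, of section0] arg_cong[OF eq, of section1] by auto
    then have "grig_a \<circ> (grig_a \<circ> (g \<circ> grig_a)) \<circ> grig_a = grig_a \<circ> (grig_a \<circ> (g' \<circ> grig_a)) \<circ> grig_a"
      by simp
    then show "g = g' \<and> h = h'" using \<open>h = h'\<close> by (simp add: comp_assoc)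
  qed
  then have "card (?A \<times> ?A) \<le> card (spelled {grig_b, grig_c} (2 * m))"
    by (rule card_inj_on_le) (auto intro: parallel_lift finite_spelled)
  then show ?thesis by (simp add: card_cartesian_product power2_eq_square)
qed

section \<open>Lifting two elements one after the other\<close>

text \<open>The closure property that keeps the error of a lift inside \<open>D\<close> from one
  letter to the next.\<close>

definition absorbs :: "('a \<Rightarrow> 'a) set \<Rightarrow> ('a \<Rightarrow> 'a) \<Rightarrow> bool" where
  "absorbs D x \<longleftrightarrow> (\<forall>\<delta>\<in>D. x \<circ> \<delta> \<in> D)"

lemma absorbs_id: "absorbs D id"
  by (simp add: absorbs_def)

lemma absorbs_comp: "absorbs D x \<Longrightarrow> absorbs D y \<Longrightarrow> absorbs D (x \<circ> y)"
  by (auto simp: absorbs_def comp_assoc)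

text \<open>The block \<open>a (a,f') a (e,t) = (f' e, a t)\<close> adds one letter on the right and
  multiplies the error on the left by \<open>f' e\<close>.\<close>

lemma serial_lift_right:
  assumes "id \<in> D" "absorbs D grig_a" "absorbs D f'"
    and "tree_pair grig_a f' \<in> T'"
    and lift: "\<And>t. t \<in> T \<Longrightarrow> \<exists>e\<in>{id, grig_a}. tree_pair e t \<in> T'"
    and "g \<in> spelled T m"
  shows "\<exists>\<delta>\<in>D. tree_pair \<delta> g \<in> spelled T' (2 * m)"
  using assms(6)
proof (induction m arbitrary: g)
  case 0
  then have "g = id" by (simp add: spelled_0)
  then show ?case using \<open>id \<in> D\<close>
    by (intro bexI[of _ id])
      (simp_all only: conj_id tree_pair_id spelled_0 mult_0_right singleton_iff)
next
  case (Suc m)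
  obtain t g' where t: "t \<in> T" "g' \<in> spelled T m" "g = grig_a \<circ> (t \<circ> g')"
    using Suc.prems by (rule spelled_SucE)
  obtain \<delta> where \<delta>: "\<delta> \<in> D" "tree_pair \<delta> g' \<in> spelled T' (2 * m)"
    using Suc.IH[OF t(2)] by blast
  obtain e where e: "e \<in> {id, grig_a}" "tree_pair e t \<in> T'" using lift[OF t(1)] by blast
  have "absorbs D (f' \<circ> e)"
    using e assms(2,3) by (intro absorbs_comp) (auto simp: absorbs_id)
  then have "f' \<circ> (e \<circ> \<delta>) \<in> D" using \<delta>(1) by (simp add: absorbs_def comp_assoc)
  moreover have "grig_a \<circ> (tree_pair grig_a f' \<circ> (grig_a \<circ> (tree_pair e t \<circ> tree_pair \<delta> g')))
      \<in> spelled T' (Suc (Suc (2 * m)))"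
    by (rule spelled_SucI[OF assms(4) spelled_SucI[OF e(2) \<delta>(2)]])
  ultimately show ?case
    by (simp only: conj_tree_pair tree_pair_comp comp_assoc t(3) grig_a_cancel
        mult_Suc_right add_2_eq_Suc) (rule bexI)
qed

text \<open>Letter and filler trade places: \<open>a (e,t) a (a,f') = (t a, e f')\<close>, so now
  the error sits on the right.\<close>

lemma serial_lift_left:
  assumes "id \<in> D" "absorbs D grig_a" "absorbs D f'"
    and "tree_pair grig_a f' \<in> T'"
    and lift: "\<And>t. t \<in> T \<Longrightarrow> \<exists>e\<in>{id, grig_a}. tree_pair e t \<in> T'"
    and "g \<in> spelled T m"
  shows "\<exists>\<delta>\<in>D. tree_pair (grig_a \<circ> (g \<circ> grig_a)) \<delta> \<in> spelled T' (2 * m)"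
  using assms(6)
proof (induction m arbitrary: g)
  case 0
  then have "g = id" by (simp add: spelled_0)
  then show ?case using \<open>id \<in> D\<close>
    by (intro bexI[of _ id])
      (simp_all only: conj_id tree_pair_id spelled_0 mult_0_right singleton_iff)
next
  case (Suc m)
  obtain t g' where t: "t \<in> T" "g' \<in> spelled T m" "g = grig_a \<circ> (t \<circ> g')"
    using Suc.prems by (rule spelled_SucE)
  obtain \<delta> where \<delta>: "\<delta> \<in> D" "tree_pair (grig_a \<circ> (g' \<circ> grig_a)) \<delta> \<in> spelled T' (2 * m)"
    using Suc.IH[OF t(2)] by blast
  obtain e where e: "e \<in> {id, grig_a}" "tree_pair e t \<in> T'" using lift[OF t(1)] by blast
  have "absorbs D (e \<circ> f')"
    using e assms(2,3) by (intro absorbs_comp) (auto simp: absorbs_id)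
  then have "e \<circ> (f' \<circ> \<delta>) \<in> D" using \<delta>(1) by (simp add: absorbs_def comp_assoc)
  moreover have "grig_a \<circ> (tree_pair e t \<circ> (grig_a \<circ> (tree_pair grig_a f' \<circ>
      tree_pair (grig_a \<circ> (g' \<circ> grig_a)) \<delta>))) \<in> spelled T' (Suc (Suc (2 * m)))"
    by (rule spelled_SucI[OF e(2) spelled_SucI[OF assms(4) \<delta>(2)]])
  ultimately show ?case
    by (simp only: conj_tree_pair tree_pair_comp comp_assoc t(3) grig_a_cancel
        mult_Suc_right add_2_eq_Suc) (rule bexI)
qed

text \<open>The errors depend on the lifted elements, so the count uses a surjection: a lift
  together with its two errors determines the pair, and there are at most \<open>K * K\<close> pairs
  of errors.\<close>

lemma card_serial_lift:
  assumes "finite D" "card D \<le> K" "\<forall>\<delta>\<in>D. bij \<delta>" "finite T'"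
    and "id \<in> D" "absorbs D grig_a" "absorbs D f'"
    and "tree_pair grig_a f' \<in> T'"
    and "\<And>t. t \<in> T \<Longrightarrow> \<exists>e\<in>{id, grig_a}. tree_pair e t \<in> T'"
  shows "(card (spelled T m))\<^sup>2 \<le> K\<^sup>2 * card (spelled T' (4 * m))"
proof -
  let ?A = "spelled T m" and ?B = "spelled T' (4 * m)"
  let ?F = "\<lambda>(\<delta>, \<epsilon>, x). (section1 x \<circ> inv_into UNIV \<epsilon>, grig_a \<circ> (inv_into UNIV \<delta> \<circ> (section0 x \<circ> grig_a)))"
  have "?A \<times> ?A \<subseteq> ?F ` (D \<times> D \<times> ?B)"
  proof clarify
    fix g h assume gh: "g \<in> ?A" "h \<in> ?A"
    obtain \<delta> where \<delta>: "\<delta> \<in> D" "tree_pair \<delta> g \<in> spelled T' (2 * m)"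
      using serial_lift_right[OF assms(5-9) gh(1)] by blast
    obtain \<epsilon> where \<epsilon>: "\<epsilon> \<in> D" "tree_pair (grig_a \<circ> (h \<circ> grig_a)) \<epsilon> \<in> spelled T' (2 * m)"
      using serial_lift_left[OF assms(5-9) gh(2)] by blast
    \<comment> \<open>The product of the right lift of \<open>g\<close> and the left lift of
      \<open>h\<close>. Cancelling the known errors from its sections recovers \<open>g\<close> and
      \<open>h\<close>.\<close>
    let ?x = "tree_pair (\<delta> \<circ> (grig_a \<circ> (h \<circ> grig_a))) (g \<circ> \<epsilon>)"
    have x: "?x \<in> ?B" using spelled_comp[OF \<delta>(2) \<epsilon>(2)] by (simp add: tree_pair_comp)
    have "inv_into UNIV \<delta> \<circ> \<delta> = id" "\<epsilon> \<circ> inv_into UNIV \<epsilon> = id"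
      using bspec[OF assms(3) \<delta>(1)] bspec[OF assms(3) \<epsilon>(1)]
      by (simp_all add: bij_is_inj bij_is_surj surj_iff[THEN iffD1])
    then have "inv_into UNIV \<delta> \<circ> (\<delta> \<circ> k) = k" "(k \<circ> \<epsilon>) \<circ> inv_into UNIV \<epsilon> = k" for k
      by (metis comp_assoc id_comp, metis comp_assoc comp_id)
    then have "?F (\<delta>, \<epsilon>, ?x) = (g, h)"
      by (simp add: comp_assoc)
    then show "(g, h) \<in> ?F ` (D \<times> D \<times> ?B)"
      using \<delta>(1) \<epsilon>(1) x by (intro image_eqI[of _ _ "(\<delta>, \<epsilon>, ?x)"]) simp_all
  qed
  then have "card (?A \<times> ?A) \<le> card (D \<times> D \<times> ?B)"
    using assms(1,4) finite_spelled by (intro surj_card_le) auto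
  also have "\<dots> \<le> K * (K * card ?B)"
    using assms(2) by (auto simp: card_cartesian_product intro!: mult_le_mono)
  finally show ?thesis by (simp add: card_cartesian_product power2_eq_square)
qed

text \<open>The errors lie in the dihedral groups \<open>\<langle>a, d\<rangle>\<close> and \<open>\<langle>a, c\<rangle>\<close>. Their finiteness is seen by
  enlarging them to iterated wreath products with \<open>\<langle>a\<rangle>\<close> over \<open>\<langle>b\<rangle>\<close>.\<close>

definition wreath_a :: "(bool list \<Rightarrow> bool list) set \<Rightarrow> (bool list \<Rightarrow> bool list) set" where
  "wreath_a D = (\<lambda>(e, p, q). e \<circ> tree_pair p q) ` ({id, grig_a} \<times> D \<times> D)"

lemma wreath_aI: "e \<in> {id, grig_a} \<Longrightarrow> p \<in> D \<Longrightarrow> q \<in> D \<Longrightarrow> e \<circ> tree_pair p q \<in> wreath_a D"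
  by (force simp: wreath_a_def)

lemma wreath_aE:
  assumes "g \<in> wreath_a D"
  obtains e p q where "e \<in> {id, grig_a}" "p \<in> D" "q \<in> D" "g = e \<circ> tree_pair p q"
  using assms by (auto simp: wreath_a_def)

lemma finite_wreath_a: "finite D \<Longrightarrow> finite (wreath_a D)"
  by (simp add: wreath_a_def)

lemma card_wreath_a:
  assumes "finite D" "card D \<le> K"
  shows "card (wreath_a D) \<le> 2 * K\<^sup>2"
proof -
  have "card (wreath_a D) \<le> card ({id, grig_a} \<times> D \<times> D)"
    unfolding wreath_a_def using assms by (intro card_image_le) simp
  also have "\<dots> = card {id, grig_a} * (card D * card D)"
    by (simp add: card_cartesian_product)
  also have "\<dots> \<le> 2 * (K * K)"
    using assms by (intro mult_le_mono) (auto simp: card_insert_if)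
  finally show ?thesis by (simp add: power2_eq_square)
qed

lemma bij_wreath_a:
  assumes "\<forall>\<delta>\<in>D. bij \<delta>"
  shows "\<forall>\<delta>\<in>wreath_a D. bij \<delta>"
proof
  fix \<delta> assume "\<delta> \<in> wreath_a D"
  then obtain e p q where epq: "e \<in> {id, grig_a}" "p \<in> D" "q \<in> D" "\<delta> = e \<circ> tree_pair p q"
    by (rule wreath_aE)
  have "bij e" using epq(1) bij_grig_a by auto
  then show "bij \<delta>"
    unfolding epq(4) using epq assms by (intro bij_comp bij_tree_pair) blast+
qed

lemma id_wreath_a: "id \<in> D \<Longrightarrow> id \<in> wreath_a D"
  using wreath_aI[of id id D id] by (simp add: tree_pair_id)

lemma absorbs_wreath_a_grig_a: "absorbs (wreath_a D) grig_a"
  unfolding absorbs_def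
proof
  fix \<delta> assume "\<delta> \<in> wreath_a D"
  then show "grig_a \<circ> \<delta> \<in> wreath_a D"
    by (rule wreath_aE) (use wreath_aI[of id _ D] wreath_aI[of grig_a _ D] in auto)
qed

text \<open>Moving \<open>(g,h)\<close> past \<open>a\<close> turns it into \<open>(h,g)\<close>, so
  each of \<open>g\<close> and \<open>h\<close> may meet either coordinate.\<close>

lemma absorbs_wreath_a:
  assumes "absorbs D g" "absorbs D h"
  shows "absorbs (wreath_a D) (tree_pair g h)"
  unfolding absorbs_def
proof
  fix \<delta> assume "\<delta> \<in> wreath_a D"
  then obtain e p q where epq: "e \<in> {id, grig_a}" "p \<in> D" "q \<in> D" "\<delta> = e \<circ> tree_pair p q"
    by (rule wreath_aE)
  have in_D: "g \<circ> p \<in> D" "h \<circ> q \<in> D" "h \<circ> p \<in> D" "g \<circ> q \<in> D"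
    using assms epq by (auto simp: absorbs_def)
  have "tree_pair g h \<circ> (grig_a \<circ> tree_pair p q) = grig_a \<circ> tree_pair (h \<circ> p) (g \<circ> q)"
    by (metis comp_assoc tree_pair_comp tree_pair_grig_a)
  then show "tree_pair g h \<circ> \<delta> \<in> wreath_a D"
    using epq in_D wreath_aI[of id _ D] wreath_aI[of grig_a _ D]
    by (auto simp: tree_pair_comp)
qed

lemma absorbs_grig_b: "absorbs {id, grig_b} grig_b"
  by (auto simp: absorbs_def grig_bcd_invol)

lemma absorbs_grig_d: "absorbs (wreath_a {id, grig_b}) grig_d"
  unfolding grig_d_pair by (intro absorbs_wreath_a absorbs_id absorbs_grig_b)

lemma absorbs_grig_c: "absorbs (wreath_a (wreath_a {id, grig_b})) grig_c"
  unfolding grig_c_pair by (intro absorbs_wreath_a absorbs_wreath_a_grig_a absorbs_grig_d)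

text \<open>The bounds are \<open>2 * 2^2 = 8\<close> and \<open>2 * 8^2 = 128\<close>.\<close>

lemma card_wreath_a_bounds:
  "card (wreath_a {id, grig_b}) \<le> 8" "card (wreath_a (wreath_a {id, grig_b})) \<le> 128"
proof -
  have "card {id, grig_b} \<le> 2" by (simp add: card_insert_if)
  from card_wreath_a[OF _ this] show "card (wreath_a {id, grig_b}) \<le> 8" by simp
  from card_wreath_a[OF _ this] show "card (wreath_a (wreath_a {id, grig_b})) \<le> 128"
    by (simp add: finite_wreath_a)
qed

lemma bij_id_grig_b: "\<forall>\<delta>\<in>{id, grig_b}. bij \<delta>"
  by (simp add: bij_grig_b)

text \<open>The filler is \<open>b = (a,c)\<close>, so \<open>f' = c\<close>; the letters
  \<open>b\<close> and \<open>c\<close> lift to \<open>d = (1,b)\<close> and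
  \<open>b = (a,c)\<close>.\<close>

lemma card_serial_lift_bc:
  "(card (spelled {grig_b, grig_c} m))\<^sup>2 \<le> 128\<^sup>2 * card (spelled {grig_b, grig_d} (4 * m))"
proof (rule card_serial_lift[OF _ card_wreath_a_bounds(2) bij_wreath_a[OF bij_wreath_a[OF
        bij_id_grig_b]] _ _ absorbs_wreath_a_grig_a absorbs_grig_c])
  show "id \<in> wreath_a (wreath_a {id, grig_b})" by (intro id_wreath_a) simp
  fix t assume "t \<in> {grig_b, grig_c}"
  then consider "t = grig_b" | "t = grig_c" by blast
  then show "\<exists>e\<in>{id, grig_a}. tree_pair e t \<in> {grig_b, grig_d}"
    by cases (simp_all flip: grig_b_pair grig_d_pair)
qed (simp_all add: finite_wreath_a flip: grig_b_pair)

text \<open>The filler is \<open>c = (a,d)\<close>, so \<open>f' = d\<close>; the letters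
  \<open>b\<close> and \<open>d\<close> lift to \<open>d = (1,b)\<close> and
  \<open>c = (a,d)\<close>.\<close>

lemma card_serial_lift_bd:
  "(card (spelled {grig_b, grig_d} m))\<^sup>2 \<le> 8\<^sup>2 * card (spelled {grig_c, grig_d} (4 * m))"
proof (rule card_serial_lift[OF _ card_wreath_a_bounds(1) bij_wreath_a[OF bij_id_grig_b]
        _ _ absorbs_wreath_a_grig_a absorbs_grig_d])
  show "id \<in> wreath_a {id, grig_b}" by (intro id_wreath_a) simp
  fix t assume "t \<in> {grig_b, grig_d}"
  then consider "t = grig_b" | "t = grig_d" by blast
  then show "\<exists>e\<in>{id, grig_a}. tree_pair e t \<in> {grig_c, grig_d}"
    by cases (simp_all flip: grig_c_pair grig_d_pair)
qed (simp_all add: finite_wreath_a flip: grig_c_pair)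

section \<open>Counting elements with letters \<open>c\<close> and \<open>d\<close>\<close>

text \<open>The lengths run through \<open>m\<close>, \<open>2 * m\<close>, \<open>8 * m\<close>,
  \<open>32 * m\<close>. The constant is \<open>(128^2)^2 * 8^2 = 2^34\<close>.\<close>

lemma card_spelled_cd_step:
  "(card (spelled {grig_c, grig_d} m)) ^ 8 \<le> 2 ^ 34 * card (spelled {grig_c, grig_d} (32 * m))"
proof -
  let ?x = "card (spelled {grig_c, grig_d} m)"
  let ?y = "card (spelled {grig_b, grig_c} (2 * m))"
  let ?z = "card (spelled {grig_b, grig_d} (8 * m))"
  have "?x ^ 8 = (?x\<^sup>2) ^ 4" by (simp flip: power_mult)
  also have "\<dots> \<le> ?y ^ 4" by (intro power_mono card_parallel_lift) simp
  also have "\<dots> = (?y\<^sup>2)\<^sup>2" by (simp flip: power_mult)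
  also have "\<dots> \<le> (128\<^sup>2 * ?z)\<^sup>2"
    using card_serial_lift_bc[of "2 * m"] by (intro power_mono) simp_all
  also have "\<dots> = 2 ^ 28 * ?z\<^sup>2" by (simp add: power_mult_distrib)
  also have "\<dots> \<le> 2 ^ 28 * (8\<^sup>2 * card (spelled {grig_c, grig_d} (32 * m)))"
    using card_serial_lift_bd[of "8 * m"] by (intro mult_left_mono) simp_all
  finally show ?thesis by simp
qed

section \<open>Lower bounds from orbits of pairs of vertices\<close>

definition orbit_step :: "(bool list \<times> bool list) list \<Rightarrow> (bool list \<times> bool list) list" where
  "orbit_step vs = remdups (concat (map (\<lambda>(u, v).
     [(grig_a (grig_c u), grig_a (grig_c v)), (grig_a (grig_d u), grig_a (grig_d v))]) vs))"

text \<open>Elements that move a fixed pair to different places are different, so the length of the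
  duplicate-free list bounds the number of elements from below.\<close>

lemma set_orbit_step:
  "set ((orbit_step ^^ m) [(u, v)]) \<subseteq> (\<lambda>g. (g u, g v)) ` spelled {grig_c, grig_d} m"
proof (induction m)
  case 0
  then show ?case by (simp add: spelled_0)
next
  case (Suc m)
  show ?case
  proof
    fix p assume "p \<in> set ((orbit_step ^^ Suc m) [(u, v)])"
    then obtain t x y where t: "t \<in> {grig_c, grig_d}"
      "(x, y) \<in> set ((orbit_step ^^ m) [(u, v)])" "p = (grig_a (t x), grig_a (t y))"
      by (auto simp: orbit_step_def)
    then obtain g where "g \<in> spelled {grig_c, grig_d} m" "x = g u" "y = g v"
      using Suc.IH by auto
    then show "p \<in> (\<lambda>g. (g u, g v)) ` spelled {grig_c, grig_d} (Suc m)"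
      using t spelled_SucI[OF t(1)] by (intro image_eqI[of _ _ "grig_a \<circ> (t \<circ> g)"]) auto
  qed
qed

lemma distinct_orbit_step: "distinct ((orbit_step ^^ m) [p])"
  by (cases m) (simp_all add: orbit_step_def)

lemma length_orbit_step:
  "64 \<le> length ((orbit_step ^^ 7) [([False, True, True, False, True],
    [True, True, True, False, True])])"
  by code_simp

text \<open>Here \<open>64 = 32 * 2 ^ (8 ^ 0)\<close> is the start of the induction below. A single
  vertex of level 5 has at most 32 images, so a pair is followed.\<close>

lemma card_spelled_cd_base: "64 \<le> card (spelled {grig_c, grig_d} 7)"
proof -
  let ?u = "[False, True, True, False, True]" and ?v = "[True, True, True, False, True]"
  let ?vs = "(orbit_step ^^ 7) [(?u, ?v)]"
  have "64 \<le> card (set ?vs)"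
    using length_orbit_step by (simp only: distinct_card distinct_orbit_step)
  also have "\<dots> \<le> card ((\<lambda>g. (g ?u, g ?v)) ` spelled {grig_c, grig_d} 7)"
    by (intro card_mono set_orbit_step finite_imageI finite_spelled) simp
  also have "\<dots> \<le> card (spelled {grig_c, grig_d} 7)"
    by (intro card_image_le finite_spelled) simp
  finally show ?thesis .
qed

text \<open>The recursion \<open>N\<^sup>8 \<le> 2\<^sup>3\<^sup>4 N'\<close> only yields growth once \<open>N\<close> exceeds a threshold, hence the base case
  with \<open>64\<close> elements. The factor \<open>32\<close> absorbs the constant, as \<open>32\<^sup>8 \<ge> 2\<^sup>3\<^sup>4 \<cdot> 32\<close>.\<close>

lemma card_spelled_cd:
  "32 * 2 ^ (8 ^ k) \<le> card (spelled {grig_c, grig_d} (7 * 32 ^ k))"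
proof (induction k)
  case 0
  then show ?case using card_spelled_cd_base by simp
next
  case (Suc k)
  have "2 ^ 34 * (32 * 2 ^ (8 ^ Suc k)) \<le> (32 * 2 ^ (8 ^ k) :: nat) ^ 8"
    by (simp add: power_mult_distrib power_mult[symmetric] mult.commute)
  also have "\<dots> \<le> (card (spelled {grig_c, grig_d} (7 * 32 ^ k))) ^ 8"
    by (intro power_mono Suc.IH) simp
  also have "\<dots> \<le> 2 ^ 34 * card (spelled {grig_c, grig_d} (32 * (7 * 32 ^ k)))"
    by (rule card_spelled_cd_step)
  finally show ?case by (simp add: mult.left_commute)
qed

section \<open>From words to weighted balls\<close>

lemma monoid_generates_word:
  assumes "monoid_generates G S" "g \<in> carrier G"
  obtains w where "w \<in> lists S" "word_prod G w = g"
  using assms by (auto simp: monoid_generates_def)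

context group
begin

lemma word_prod_closed: "w \<in> lists (carrier G) \<Longrightarrow> word_prod G w \<in> carrier G"
  by (induction w) (auto simp: word_prod_def)

lemma word_prod_append:
  "v \<in> lists (carrier G) \<Longrightarrow> w \<in> lists (carrier G) \<Longrightarrow>
    word_prod G (v @ w) = word_prod G v \<otimes> word_prod G w"
proof (induction v)
  case Nil
  then show ?case using word_prod_closed[of w] by (simp add: word_prod_def)
next
  case (Cons s v)
  then show ?case using word_prod_closed[of v] word_prod_closed[of w]
    by (auto simp: word_prod_def m_assoc)
qed

end

text \<open>The least weight of a generator bounds the length of a word of weight at most
  \<open>r\<close>. Finiteness matters because \<open>card\<close> is 0 on infinite sets, which
  would break \<open>card_mono\<close>.\<close>

lemma finite_weight_ball:
  assumes "finite S" "is_weight S \<omega>" "monoid_generates G S"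
  shows "finite {g \<in> carrier G. weight_norm G S \<omega> g \<le> r}"
proof -
  \<comment> \<open>Inserting 1 keeps \<open>Min\<close> meaningful when \<open>S\<close> is
    empty.\<close>
  define m where "m = Min (insert 1 (\<omega> ` S))"
  have m: "m > 0" "\<And>s. s \<in> S \<Longrightarrow> m \<le> \<omega> s"
    using assms by (auto simp: is_weight_def m_def)
  have len: "m * length w \<le> sum_list (map \<omega> w)" if "w \<in> lists S" for w
    using that by (induction w) (auto simp: algebra_simps dest: m(2))
  have "{g \<in> carrier G. weight_norm G S \<omega> g \<le> r}
      \<subseteq> word_prod G ` {w. set w \<subseteq> S \<and> length w \<le> nat \<lceil>r / m\<rceil>}"
  proof clarify
    fix g assume "g \<in> carrier G" "weight_norm G S \<omega> g \<le> r"
    then obtain w where w: "w \<in> lists S" "word_prod G w = g" "sum_list (map \<omega> w) \<le> r"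
      using weight_norm_attained(1)[OF assms] by metis
    then have "m * length w \<le> r" using len[of w] by linarith
    then have "real (length w) \<le> r / m" using m(1) by (simp add: field_simps)
    then have "length w \<le> nat \<lceil>r / m\<rceil>" by linarith
    then show "g \<in> word_prod G ` {w. set w \<subseteq> S \<and> length w \<le> nat \<lceil>r / m\<rceil>}"
      using w by auto
  qed
  then show ?thesis
    using finite_lists_length_le[OF assms(1)] finite_surj by blast
qed

section \<open>The Grigorchuk group as a group of maps under composition\<close>

lemma group_grigorchuk: "group grigorchuk_group"
  unfolding grigorchuk_group_def by (intro group.group_subgroup_generated group_BijGroup)

lemma carrier_grigorchuk_subset: "carrier grigorchuk_group \<subseteq> carrier (BijGroup UNIV)"
  unfolding grigorchuk_group_def by (intro group.carrier_subgroup_generated_subset group_BijGroup)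

text \<open>The product of \<open>BijGroup\<close> is restricted to its carrier; there, over
  \<open>UNIV\<close>, it is plain composition.\<close>

lemma mult_grigorchuk:
  "g \<in> carrier grigorchuk_group \<Longrightarrow> h \<in> carrier grigorchuk_group \<Longrightarrow>
    g \<otimes>\<^bsub>grigorchuk_group\<^esub> h = g \<circ> h"
  using carrier_grigorchuk_subset
  by (auto simp: grigorchuk_group_def BijGroup_def compose_def restrict_def)

lemma one_grigorchuk: "\<one>\<^bsub>grigorchuk_group\<^esub> = id"
  by (auto simp: grigorchuk_group_def BijGroup_def)

lemma gens_in_grigorchuk: "grig_gens \<subseteq> carrier grigorchuk_group"
  by (rule conjunct1[OF grig_gens_generate[unfolded monoid_generates_def]])

lemma comp_in_grigorchuk:
  "g \<in> carrier grigorchuk_group \<Longrightarrow> h \<in> carrier grigorchuk_group \<Longrightarrow>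
    g \<circ> h \<in> carrier grigorchuk_group"
  using group.is_monoid[OF group_grigorchuk, THEN monoid.m_closed] by (metis mult_grigorchuk)

lemma id_in_grigorchuk: "id \<in> carrier grigorchuk_group"
  using group.is_monoid[OF group_grigorchuk, THEN monoid.one_closed] by (metis one_grigorchuk)

text \<open>Each of the two blocks \<open>a c\<close> and \<open>a d\<close> is replaced by a fixed
  word over \<open>S\<close>, so the weight is at most linear in the number of blocks.\<close>

lemma word_map_short:
  assumes "monoid_generates grigorchuk_group S"
  obtains M :: real where "M > 0"
    "\<And>m g. g \<in> spelled {grig_c, grig_d} m \<Longrightarrow>
      g \<in> carrier grigorchuk_group \<and>
      (\<exists>w\<in>lists S. word_prod grigorchuk_group w = g \<and> sum_list (map \<omega> w) \<le> M * real m)"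
proof -
  let ?G = grigorchuk_group
  interpret group ?G by (rule group_grigorchuk)
  have S: "lists S \<subseteq> lists (carrier ?G)"
    by (rule lists_mono[OF conjunct1[OF assms[unfolded monoid_generates_def]]])
  have gens: "grig_a \<in> carrier ?G" "grig_c \<in> carrier ?G" "grig_d \<in> carrier ?G"
    using gens_in_grigorchuk by (auto simp: grig_gens_def)
  obtain u where u: "u \<in> lists S" "word_prod ?G u = grig_a \<circ> grig_c"
    using monoid_generates_word[OF assms] gens comp_in_grigorchuk by blast
  obtain v where v: "v \<in> lists S" "word_prod ?G v = grig_a \<circ> grig_d"
    using monoid_generates_word[OF assms] gens comp_in_grigorchuk by blast
  define M where "M = max 1 (max (sum_list (map \<omega> u)) (sum_list (map \<omega> v)))"
  have block: "\<exists>w\<in>lists S. word_prod ?G w = grig_a \<circ> t \<and> sum_list (map \<omega> w) \<le> M"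
    if "t \<in> {grig_c, grig_d}" for t
  proof -
    from that consider "t = grig_c" | "t = grig_d" by blast
    then show ?thesis
    proof cases
      case 1
      then show ?thesis using u by (intro bexI[of _ u]) (simp_all add: M_def)
    next
      case 2
      then show ?thesis using v by (intro bexI[of _ v]) (simp_all add: M_def)
    qed
  qed
  show thesis
  proof (rule that[of M])
    show "M > 0" by (simp add: M_def)
    fix m g assume "g \<in> spelled {grig_c, grig_d} m"
    then show "g \<in> carrier ?G \<and>
      (\<exists>w\<in>lists S. word_prod ?G w = g \<and> sum_list (map \<omega> w) \<le> M * real m)"
    proof (induction m arbitrary: g)
      case 0
      then have "g = id" by (simp add: spelled_0)
      moreover have "word_prod ?G [] = id" by (simp only: word_prod_def foldr_Nil id_apply one_grigorchuk)
      ultimately show ?case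
        using id_in_grigorchuk by (intro conjI bexI[of _ "[]"]) (simp_all only:, simp_all)
    next
      case (Suc m)
      obtain t h where t: "t \<in> {grig_c, grig_d}" "h \<in> spelled {grig_c, grig_d} m"
        "g = grig_a \<circ> (t \<circ> h)" using Suc.prems by (rule spelled_SucE)
      have at: "grig_a \<circ> t \<in> carrier ?G" using t(1) gens comp_in_grigorchuk by auto
      have h: "h \<in> carrier ?G" using Suc.IH t(2) by blast
      obtain w where w: "w \<in> lists S" "word_prod ?G w = h" "sum_list (map \<omega> w) \<le> M * m"
        using Suc.IH t(2) by blast
      obtain x where x: "x \<in> lists S" "word_prod ?G x = grig_a \<circ> t" "sum_list (map \<omega> x) \<le> M"
        using block t(1) by blast
      have g: "g = (grig_a \<circ> t) \<circ> h" by (simp add: t(3) comp_assoc)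
      have "word_prod ?G (x @ w) = g"
        using word_prod_append[of x w] subsetD[OF S x(1)] subsetD[OF S w(1)]
        by (simp only: w(2) x(2) mult_grigorchuk[OF at h] g)
      moreover have "sum_list (map \<omega> (x @ w)) \<le> M * Suc m"
        using w(3) x(3) by (simp add: algebra_simps)
      ultimately show ?case
        using w(1) x(1) comp_in_grigorchuk[OF at h, folded g]
        by (intro conjI bexI[of _ "x @ w"]) simp_all
    qed
  qed
qed

lemma growth_fun_lower_bound:
  assumes "finite S" "is_weight S \<omega>" "monoid_generates grigorchuk_group S"
  obtains M :: real where "M > 0"
    "\<And>k. 2 ^ (8 ^ k) \<le> growth_fun grigorchuk_group S \<omega> (M * 32 ^ k)"
proof -
  obtain M :: real where M: "M > 0" "\<And>m g. g \<in> spelled {grig_c, grig_d} m \<Longrightarrow>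
      g \<in> carrier grigorchuk_group \<and>
      (\<exists>w\<in>lists S. word_prod grigorchuk_group w = g \<and> sum_list (map \<omega> w) \<le> M * real m)"
    by (rule word_map_short[OF assms(3), where \<omega> = \<omega>]) blast
  show thesis
  proof (rule that[of "7 * M"])
    show "7 * M > 0" using M(1) by simp
    fix k
    have M_k: "M * real (7 * 32 ^ k) = 7 * M * 32 ^ k" by simp
    let ?B = "{g \<in> carrier grigorchuk_group.
      weight_norm grigorchuk_group S \<omega> g \<le> 7 * M * 32 ^ k}"
    have "spelled {grig_c, grig_d} (7 * 32 ^ k) \<subseteq> ?B"
    proof
      fix g assume g: "g \<in> spelled {grig_c, grig_d} (7 * 32 ^ k)"
      obtain w where w: "w \<in> lists S" "word_prod grigorchuk_group w = g"
        "sum_list (map \<omega> w) \<le> 7 * M * 32 ^ k"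
        using M(2)[OF g] unfolding M_k by blast
      have carrier: "g \<in> carrier grigorchuk_group" using M(2)[OF g] by blast
      have "weight_norm grigorchuk_group S \<omega> g \<le> 7 * M * 32 ^ k"
        using weight_norm_attained(2)[OF assms carrier w(1,2)] w(3) by (rule order_trans)
      with carrier show "g \<in> ?B" by blast
    qed
    then have "card (spelled {grig_c, grig_d} (7 * 32 ^ k)) \<le> card ?B"
      by (intro card_mono finite_weight_ball assms)
    with card_spelled_cd[of k] have "32 * 2 ^ (8 ^ k) \<le> card ?B" by (rule order_trans)
    \<comment> \<open>The factor 32 served the induction on \<open>k\<close> and is dropped
      here.\<close>
    moreover have "x \<le> 32 * x" for x :: nat by simp
    ultimately have "2 ^ (8 ^ k) \<le> card ?B" by (rule order_trans[rotated])
    then have "real (2 ^ (8 ^ k)) \<le> real (card ?B)"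
      by (rule of_nat_mono)
    then show "2 ^ (8 ^ k) \<le> growth_fun grigorchuk_group S \<omega> (7 * M * 32 ^ k)"
      by (simp only: growth_fun_def of_nat_power of_nat_numeral)
  qed
qed

text \<open>Rounding \<open>n\<close> up to a power \<open>32 ^ j\<close> costs a factor 32, and
  \<open>32 powr (3/5) = 8\<close>. Passing from base \<open>e\<close> to base 2 raises
  \<open>j\<close> by one, which costs another 32; hence \<open>1024 = 32^2\<close>.\<close>

lemma exp_powr_le_two_power:
  fixes n :: real
  assumes "1 \<le> n"
  obtains k where "32 ^ k \<le> 1024 * n" "exp (n powr (3/5)) \<le> 2 ^ (8 ^ k)"
proof -
  define j where "j = nat \<lceil>log 32 n\<rceil>"
  \<comment> \<open>Since \<open>n \<ge> 1\<close>, the logarithm is nonnegative and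
    \<open>nat\<close> does not truncate.\<close>
  have j: "log 32 n \<le> j" "j \<le> log 32 n + 1"
    using assms by (auto simp: j_def)
  have lower: "n \<le> 32 ^ j"
    using j(1) assms by (simp add: log_le_iff powr_realpow)
  have "32 powr j \<le> 32 powr (log 32 n + 1)" using j(2) by (intro powr_mono) auto
  also have "\<dots> = 32 * n" using assms by (simp add: powr_add)
  finally have upper: "32 ^ j \<le> 32 * n" by (simp add: powr_realpow)
  have "(32::real) powr (3/5) = (2 powr 5) powr (3/5)" by simp
  also have "\<dots> = 2 powr 3" by (simp only: powr_powr) simp
  finally have eight: "(32::real) powr (3/5) = 8" by simp
  have "((32::real) ^ j) powr (3/5) = (32 powr (3/5)) powr j"
    by (simp only: powr_realpow[symmetric] powr_powr mult.commute zero_less_numeral)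
  also have "\<dots> = 8 ^ j" by (simp only: eight powr_realpow zero_less_numeral)
  finally have "n powr (3/5) \<le> 8 ^ j"
    using powr_mono2[OF _ _ lower, of "3/5"] assms by linarith
  then have "exp (n powr (3/5)) \<le> exp (8 ^ j)" by (simp only: exp_le_cancel_iff)
  also have "\<dots> = exp 1 ^ (8 ^ j)"
    using exp_of_nat_mult[of "8 ^ j" "1::real"] by (simp only: of_nat_power of_nat_numeral mult_1_right)
  \<comment> \<open>The crude bound \<open>e \<le> 2 ^ 8\<close> is chosen so that its exponent
    merges into \<open>8 ^ Suc j\<close>.\<close>
  also have "\<dots> \<le> (2 ^ 8) ^ (8 ^ j)"
    by (rule power_mono) (use exp_le in auto)
  also have "\<dots> = 2 ^ (8 ^ Suc j)" by (simp only: power_mult[symmetric] power_Suc)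
  finally have "exp (n powr (3/5)) \<le> 2 ^ (8 ^ Suc j)" .
  moreover have "32 ^ Suc j \<le> 1024 * n" using upper by simp
  ultimately show thesis by (rule that[rotated])
qed

theorem theorem1:
  fixes \<gamma> :: "real \<Rightarrow> real" and \<alpha> :: real
  assumes "\<gamma> \<in> growth grigorchuk_group"
    and "\<alpha> = 0.5157"
  shows "dominated_on {1..} (\<lambda>n. exp (n powr \<alpha>)) \<gamma>"
proof -
  obtain S \<omega> where S: "finite S" "is_weight S \<omega>" "monoid_generates grigorchuk_group S"
    and "growth_equiv \<gamma> (growth_fun grigorchuk_group S \<omega>)"
    using assms(1) by (auto simp: growth_def)
  then obtain C where C: "C \<ge> 0"
    "\<And>n. n \<ge> 0 \<Longrightarrow> growth_fun grigorchuk_group S \<omega> n \<le> \<gamma> (C * n)"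
    by (auto simp: growth_equiv_def dominated_on_def)
  obtain M :: real where M: "M > 0"
    "\<And>k. 2 ^ (8 ^ k) \<le> growth_fun grigorchuk_group S \<omega> (M * 32 ^ k)"
    by (rule growth_fun_lower_bound[OF S]) blast
  have mono: "growth_fun grigorchuk_group S \<omega> r \<le> growth_fun grigorchuk_group S \<omega> s"
    if "r \<le> s" for r s
    using that unfolding growth_fun_def
    by (intro of_nat_mono card_mono finite_weight_ball S) auto
  have "exp (n powr \<alpha>) \<le> \<gamma> (C * (M * 1024) * n)" if n: "n \<ge> 1" for n
  proof -
    obtain k where k: "32 ^ k \<le> 1024 * n" "exp (n powr (3/5)) \<le> 2 ^ (8 ^ k)"
      using exp_powr_le_two_power[OF n] .
    \<comment> \<open>For \<open>n \<ge> 1\<close> the power grows with the exponent, and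
      \<open>0.5157 < 3/5\<close>.\<close>
    have "exp (n powr \<alpha>) \<le> exp (n powr (3/5))"
      using n assms(2) by (simp add: powr_mono)
    also have "\<dots> \<le> 2 ^ (8 ^ k)" by (rule k)
    also have "\<dots> \<le> growth_fun grigorchuk_group S \<omega> (M * 32 ^ k)" by (rule M)
    also have "\<dots> \<le> growth_fun grigorchuk_group S \<omega> (M * (1024 * n))"
      using k(1) M(1) by (intro mono mult_left_mono) auto
    also have "\<dots> \<le> \<gamma> (C * (M * (1024 * n)))"
      using M(1) n by (intro C) simp
    finally show ?thesis by (simp add: mult.assoc)
  qed
  then show ?thesis
    using C(1) M(1) unfolding dominated_on_def
    by (intro exI[of _ "C * (M * 1024)"]) auto
qed

end
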